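(* Let $n>344569$. For every outerplanar bipartite graph $G$ on $n$ vertices, $\rho(G)\leq \rho(K_{1,n-1})$; that is, among all outerplanar bipartite graphs on $n$ vertices, the star $K_{1,n-1}$ attains the maximum spectral radius.
   Context: For a graph $G$, $\rho(G)$ denotes the spectral radius of $G$, i.e. the largest eigenvalue of its adjacency matrix. A graph is outerplanar if it has a planar embedding in which all vertices lie on the boundary of the outer face. $K_{1,n-1}$ is the star on $n$ vertices. *)

theory Defs
  imports
    "HOL-Analysis.Analysis"
    "Graph_Theory.Kuratowski"
    "Jordan_Normal_Form.Spectral_Radius"
begin

text \<open>
  Finite simple graphs are the \<^locale>\<open>pair_graph\<close>s of the Graph Theory library: finite, symmetric,
  loopless digraphs whose arcs are pairs of vertices. An undirected edge is therefore present as
  the two arcs \<open>(u, v)\<close> and \<open>(v, u)\<close>.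
\<close>

definition bipartite :: "'a pair_pre_digraph \<Rightarrow> bool" where
  "bipartite G \<longleftrightarrow>
     (\<exists>U W. pverts G = U \<union> W \<and> U \<inter> W = {} \<and> parcs G \<subseteq> U \<times> W \<union> W \<times> U)"

text \<open>
  A planar embedding sends vertices to distinct points of the plane \<^typ>\<open>complex\<close> and edges to
  (continuous) arcs joining the images of their end vertices; arcs meet the set of vertex points
  and each other only in common end vertices. The two arcs \<open>(u, v)\<close> and \<open>(v, u)\<close> of the same
  undirected edge are drawn as one curve, traversed in opposite directions.
\<close>

definition planar_embedding ::
    "'a pair_pre_digraph \<Rightarrow> ('a \<Rightarrow> complex) \<Rightarrow> ('a \<times> 'a \<Rightarrow> real \<Rightarrow> complex) \<Rightarrow> bool" where
  "planar_embedding G pos crv \<longleftrightarrow>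
     inj_on pos (pverts G) \<and>
     (\<forall>(u, v) \<in> parcs G.
        arc (crv (u, v)) \<and> pathstart (crv (u, v)) = pos u \<and> pathfinish (crv (u, v)) = pos v \<and>
        crv (v, u) = reversepath (crv (u, v)) \<and>
        path_image (crv (u, v)) \<inter> pos ` pverts G = {pos u, pos v}) \<and>
     (\<forall>(u, v) \<in> parcs G. \<forall>(x, y) \<in> parcs G. {u, v} \<noteq> {x, y} \<longrightarrow>
        path_image (crv (u, v)) \<inter> path_image (crv (x, y)) \<subseteq> pos ` ({u, v} \<inter> {x, y}))"

definition drawing ::
    "'a pair_pre_digraph \<Rightarrow> ('a \<Rightarrow> complex) \<Rightarrow> ('a \<times> 'a \<Rightarrow> real \<Rightarrow> complex) \<Rightarrow> complex set" where
  "drawing G pos crv = pos ` pverts G \<union> (\<Union>e \<in> parcs G. path_image (crv e))"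

text \<open>
  The outer face is the unbounded connected component of the complement of the drawing. The
  drawing of a finite graph is compact, so this component is unique and coincides with the
  library's \<^const>\<open>outside\<close>.
\<close>

definition outerplanar :: "'a pair_pre_digraph \<Rightarrow> bool" where
  "outerplanar G \<longleftrightarrow>
     (\<exists>pos crv. planar_embedding G pos crv \<and>
        (\<forall>v \<in> pverts G. pos v \<in> frontier (outside (drawing G pos crv))))"

text \<open>The adjacency matrix with respect to an enumeration \<open>vs\<close> of the vertices.\<close>

definition adjacency_matrix :: "'a pair_pre_digraph \<Rightarrow> 'a list \<Rightarrow> real mat" where
  "adjacency_matrix G vs =
     mat (length vs) (length vs) (\<lambda>(i, j). if (vs ! i, vs ! j) \<in> parcs G then 1 else 0)"

text \<open>
  The enumeration chosen below is irrelevant, see \<open>spectrum_adjacency_matrix_unique\<close>. Note that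
  \<^const>\<open>spectrum\<close> is taken over the reals.
\<close>

definition graph_spectral_radius :: "'a pair_pre_digraph \<Rightarrow> real" (\<open>\<rho>\<close>) where
  "\<rho> G = Max (spectrum (adjacency_matrix G (SOME vs. distinct vs \<and> set vs = pverts G)))"

lemma spectrum_adjacency_matrix_subset:
  assumes "distinct xs" "distinct ys" "set xs = set ys"
  shows "spectrum (adjacency_matrix G xs) \<subseteq> spectrum (adjacency_matrix G ys)"
proof
  fix k assume k: "k \<in> spectrum (adjacency_matrix G xs)"
  have "mset ys = mset xs"
    using assms by (metis set_eq_iff_mset_eq_distinct)
  then obtain p where p: "p permutes {..<length xs}" "permute_list p xs = ys"
    by (metis mset_eq_permutation)
  define n where "n = length xs"
  have pn: "p permutes {..<n}" and ly: "length ys = n"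
    using p by (auto simp: n_def)
  have pi: "p i < n" if "i < n" for i
    using permutes_in_image[OF pn, of i] that by simp
  have ynth: "ys ! i = xs ! p i" if "i < n" for i
    using p that by (auto simp: permute_list_nth n_def)
  define a where "a = (\<lambda>i j. if (xs ! i, xs ! j) \<in> parcs G then 1 else (0 :: real))"
  have X: "adjacency_matrix G xs = mat n n (\<lambda>(i, j). a i j)"
    by (simp add: adjacency_matrix_def a_def n_def)
  have Y: "adjacency_matrix G ys = mat n n (\<lambda>(i, j). a (p i) (p j))"
    by (rule eq_matI) (auto simp: adjacency_matrix_def a_def ly ynth)
  from k obtain v where v: "v \<in> carrier_vec n" "v \<noteq> 0\<^sub>v n"
    and ev: "mat n n (\<lambda>(i, j). a i j) *\<^sub>v v = k \<cdot>\<^sub>v v"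
    unfolding spectrum_def eigenvalue_def eigenvector_def X by auto
  define w where "w = vec n (\<lambda>i. vec_index v (p i))"
  have evi: "(\<Sum>j<n. a i j * vec_index v j) = k * vec_index v i" if "i < n" for i
  proof -
    have "vec_index (mat n n (\<lambda>(i, j). a i j) *\<^sub>v v) i = k * vec_index v i"
      using ev v that by simp
    then show ?thesis
      using v that by (simp add: scalar_prod_def lessThan_atLeast0)
  qed
  have "mat n n (\<lambda>(i, j). a (p i) (p j)) *\<^sub>v w = k \<cdot>\<^sub>v w"
  proof (rule eq_vecI)
    fix i assume "i < dim_vec (k \<cdot>\<^sub>v w)"
    then have i: "i < n" by (simp add: w_def)
    have "(\<Sum>j<n. a (p i) (p j) * vec_index v (p j)) = (\<Sum>j<n. a (p i) j * vec_index v j)"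
      using sum.permute[OF pn, of "\<lambda>j. a (p i) j * vec_index v j"] by (simp add: comp_def)
    with evi[OF pi[OF i]] i show
      "vec_index (mat n n (\<lambda>(i, j). a (p i) (p j)) *\<^sub>v w) i = vec_index (k \<cdot>\<^sub>v w) i"
      by (simp add: w_def scalar_prod_def lessThan_atLeast0)
  qed (simp add: w_def)
  moreover have "w \<noteq> 0\<^sub>v n"
  proof
    assume w0: "w = 0\<^sub>v n"
    have "vec_index v i = 0" if "i < n" for i
    proof -
      have "i \<in> p ` {..<n}" using permutes_image[OF pn] that by simp
      then obtain j where "j < n" "i = p j" by auto
      then show ?thesis using arg_cong[OF w0, of "\<lambda>u. vec_index u j"] by (simp add: w_def)
    qed
    with v show False by (metis carrier_vecD eq_vecI index_zero_vec)
  qed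
  ultimately show "k \<in> spectrum (adjacency_matrix G ys)"
    unfolding spectrum_def eigenvalue_def eigenvector_def Y
    by (auto intro!: exI[of _ w] simp: w_def)
qed

lemma spectrum_adjacency_matrix_unique:
  assumes "distinct xs" "distinct ys" "set xs = set ys"
  shows "spectrum (adjacency_matrix G xs) = spectrum (adjacency_matrix G ys)"
  using assms by (intro equalityI spectrum_adjacency_matrix_subset) auto

lemma graph_spectral_radius_eq:
  assumes "distinct vs" "set vs = pverts G"
  shows "\<rho> G = Max (spectrum (adjacency_matrix G vs))"
proof -
  let ?P = "\<lambda>vs. distinct vs \<and> set vs = pverts G"
  have "?P (SOME vs. ?P vs)"
    using assms by (intro someI[of ?P vs]) simp
  with assms show ?thesis
    unfolding graph_spectral_radius_def
    by (metis spectrum_adjacency_matrix_unique)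
qed

end

theory Submission
  imports Defs "HOL-Complex_Analysis.Winding_Numbers"
begin

text \<open>
  In an outerplanar drawing no two nonadjacent vertices are joined by three internally disjoint
  paths: each path would lie outside the cycle formed by the other two, contradicting that the
  winding numbers of the three cycles add up to zero. Consequently two vertices have at most two
  common neighbours, and in a breadth-first layering of a bipartite outerplanar graph every vertex
  has at most two neighbours in the preceding layer (three of them could be followed towards the
  root until they meet), so the number of edges is at most twice the number of vertices.

  Let \<open>x\<close> be the absolute value of an eigenvector for \<open>\<mu>\<close>, scaled to have maximal entry \<open>x u = 1\<close>, and
  suppose \<open>\<mu>\<^sup>2 > n - 1\<close>. The edge bound makes \<open>\<Sum>v. x v\<close> small compared with \<open>n\<close>. Evaluating the square of
  the adjacency matrix at \<open>u\<close> shows that \<open>u\<close> has nearly \<open>n\<close> neighbours, so any other vertex \<open>w\<close> has small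
  degree, and evaluating it at \<open>w\<close> yields \<open>x w \<le> 1/2\<close>. Since \<open>u\<close> and \<open>w\<close> have at most two common
  neighbours, \<open>\<mu>\<^sup>2\<close> is then at most the number of vertices at distance one or two from \<open>u\<close>.
\<close>

subsection \<open>Theta curves and outer boundaries\<close>

text \<open>Without its ends the arc is connected and misses \<open>J\<close>, so it lies in one
  component of \<open>- J\<close>. The point \<open>m\<close> decides which one: it is a limit of
  \<open>outside T\<close>, hence in \<open>J\<close> or \<open>outside J\<close>, and it is not in
  \<open>J\<close>.\<close>

lemma arc_interior_subset_outside:
  fixes g :: "real \<Rightarrow> complex"
  assumes g: "arc g" "pathstart g = a" "pathfinish g = b"
    and J: "closed J" "path_image g \<inter> J \<subseteq> {a, b}" "J \<subseteq> T"
    and m: "m \<in> path_image g" "m \<notin> {a, b}" "m \<in> closure (outside T)"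
  shows "path_image g - {a, b} \<subseteq> outside J"
proof
  fix x assume x: "x \<in> path_image g - {a, b}"
  have "m \<in> J \<union> outside J"
    using m(3) closure_mono[OF outside_mono[OF J(3)]] closure_outside_subset[OF J(1)] by blast
  with J(2) m have "m \<in> outside J" by blast
  moreover have "topological_space_class.connected (path_image g - {a, b})"
    using connected_simple_path_endless[OF arc_imp_simple_path[OF g(1)]] g(2,3) by simp
  then have "connected_component (- J) m x"
    unfolding connected_component_def using x m J(2)
    by (intro exI[of _ "path_image g - {a, b}"]) auto
  ultimately show "x \<in> outside J"
    by (rule outside_same_component[rotated])
qed

text \<open>A connected set missing \<open>K\<close> stays in one component of \<open>- K\<close>;
  applied to both insides this gives the two inclusions.\<close>

lemma inside_eq_of_meet:
  assumes "topological_space_class.connected (inside J)" "topological_space_class.connected (inside K)"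
    and "inside J \<inter> K = {}" "inside K \<inter> J = {}" "inside J \<inter> inside K \<noteq> {}"
  shows "inside J = inside K"
proof -
  have sub: "inside J \<subseteq> inside K"
    if "topological_space_class.connected (inside J)" "inside J \<inter> K = {}" "inside J \<inter> inside K \<noteq> {}" for J K :: "'a set"
  proof
    fix x assume x: "x \<in> inside J"
    from that(3) obtain z where z: "z \<in> inside J" "z \<in> inside K" by blast
    have "connected_component (- K) z x"
      unfolding connected_component_def using that x z
      by (intro exI[of _ "inside J"]) auto
    with z(2) show "x \<in> inside K" by (rule inside_same_component[rotated])
  qed
  show ?thesis
    using sub[of J K] sub[of K J] assms by blast
qed

locale theta_curve =
  fixes a b :: complex and g :: "nat \<Rightarrow> real \<Rightarrow> complex"
  assumes arcs: "i < 3 \<Longrightarrow> arc (g i)"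
    and starts: "i < 3 \<Longrightarrow> pathstart (g i) = a"
    and ends: "i < 3 \<Longrightarrow> pathfinish (g i) = b"
    and meets: "i < 3 \<Longrightarrow> j < 3 \<Longrightarrow> i \<noteq> j \<Longrightarrow> path_image (g i) \<inter> path_image (g j) \<subseteq> {a, b}"
begin

abbreviation curve :: "nat \<Rightarrow> nat \<Rightarrow> complex set" where
  "curve i j \<equiv> path_image (g i) \<union> path_image (g j)"

lemma path_image_loop: "i < 3 \<Longrightarrow> j < 3 \<Longrightarrow> path_image (g i +++ reversepath (g j)) = curve i j"
  by (simp add: path_image_join ends)

lemma simple_loop: "i < 3 \<Longrightarrow> j < 3 \<Longrightarrow> i \<noteq> j \<Longrightarrow> simple_path (g i +++ reversepath (g j))"
  using meets[of i j] by (intro simple_path_join_loop) (auto simp: arcs starts ends arc_reversepath)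

lemma
  assumes "i < 3" "j < 3" "i \<noteq> j"
  shows inside_curve_nonempty: "inside (curve i j) \<noteq> {}"
    and connected_inside_curve: "topological_space_class.connected (inside (curve i j))"
    and frontier_inside_curve: "frontier (inside (curve i j)) = curve i j"
  using Jordan_inside_outside[OF simple_loop[OF assms]] assms
  by (simp_all add: path_image_loop starts)

lemma winding_loop:
  assumes "i < 3" "j < 3" "z \<notin> curve i j"
  shows "winding_number (g i +++ reversepath (g j)) z = winding_number (g i) z - winding_number (g j) z"
  using assms by (simp add: winding_number_join winding_number_reversepath arcs arc_imp_path ends)

text \<open>The three loops of a theta curve have winding numbers adding up to zero.\<close>

lemma inside_curve_cases:
  assumes ijk: "i < 3" "j < 3" "k < 3" "i \<noteq> j" "i \<noteq> k" "j \<noteq> k"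
    and z: "z \<in> inside (curve i j)" "z \<notin> path_image (g k)"
  shows "z \<in> inside (curve i k) \<or> z \<in> inside (curve j k)"
proof (rule ccontr)
  have nz: "z \<notin> path_image (g i)" "z \<notin> path_image (g j)"
    using z(1) inside_no_overlap[of "curve i j"] by blast+
  assume neg: "\<not> ?thesis"
  \<comment> \<open>If \<open>z\<close> is outside both other loops, the open arcs \<open>i\<close>
    and \<open>j\<close> have the same winding number about \<open>z\<close> as \<open>k\<close>.
    Then the loop of \<open>i\<close> and \<open>j\<close> has winding number 0, whereas a point
    inside a simple closed curve gives norm 1.\<close>
  have "winding_number (g p +++ reversepath (g k)) z = 0" if "p \<in> {i, j}" for p
  proof (rule winding_number_zero_in_outside)
    have p: "p < 3" "p \<noteq> k" using that ijk by auto
    show "path (g p +++ reversepath (g k))"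
      using simple_loop[OF p(1) ijk(3) p(2)] by (rule simple_path_imp_path)
    show "pathfinish (g p +++ reversepath (g k)) = pathstart (g p +++ reversepath (g k))"
      using p ijk by (simp add: starts)
    have "z \<in> - curve p k" "z \<notin> inside (curve p k)"
      using neg that nz z(2) by auto
    then show "z \<in> outside (path_image (g p +++ reversepath (g k)))"
      unfolding path_image_loop[OF p(1) ijk(3)] inside_Un_outside[symmetric] by blast
  qed
  from this[of i] this[of j]
  have "winding_number (g i) z = winding_number (g j) z"
    using nz z(2) ijk by (simp add: winding_loop)
  then have "winding_number (g i +++ reversepath (g j)) z = 0"
    using nz ijk by (simp add: winding_loop)
  moreover have "norm (winding_number (g i +++ reversepath (g j)) z) = 1"
    by (rule simple_closed_path_norm_winding_number_inside)
      (use simple_loop ijk z(1) path_image_loop in auto)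
  ultimately show False by simp
qed

text \<open>No arc enters the inside of the loop formed by the other two, which makes the three
  insides pairwise disjoint. But \<open>inside_curve_cases\<close> puts a point inside one loop also
  inside another.\<close>

lemma not_all_on_outer_boundary:
  assumes m: "\<And>i. i < 3 \<Longrightarrow> m i \<in> path_image (g i)" "\<And>i. i < 3 \<Longrightarrow> m i \<notin> {a, b}"
    and outer: "\<And>i. i < 3 \<Longrightarrow> m i \<in> closure (outside (\<Union>i<3. path_image (g i)))"
  shows False
proof -
  let ?T = "\<Union>i<3. path_image (g i)"
  have closed: "closed (curve i j)" if "i < 3" "j < 3" for i j
    using that by (intro closed_Un closed_path_image arc_imp_path arcs)
  have disj: "inside (curve i j) \<inter> path_image (g k) = {}"
    if ijk: "i < 3" "j < 3" "k < 3" "i \<noteq> k" "j \<noteq> k" for i j k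
  proof -
    have "path_image (g k) - {a, b} \<subseteq> outside (curve i j)"
    proof (rule arc_interior_subset_outside[where T = ?T and m = "m k"])
      show "path_image (g k) \<inter> curve i j \<subseteq> {a, b}"
        using meets[of k i] meets[of k j] ijk by auto
    qed (use ijk m outer closed in \<open>auto simp: arcs starts ends\<close>)
    moreover have "{a, b} \<subseteq> curve i j"
      using pathstart_in_path_image[of "g i"] pathfinish_in_path_image[of "g i"] ijk
      by (auto simp: starts ends)
    ultimately show ?thesis
      using inside_no_overlap[of "curve i j"] inside_Int_outside[of "curve i j"] by blast
  qed
  have distinct: "inside (curve i j) \<inter> inside (curve i k) = {}"
    if ijk: "i < 3" "j < 3" "k < 3" "i \<noteq> j" "i \<noteq> k" "j \<noteq> k" for i j k
  proof (rule ccontr)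
    assume meet: "inside (curve i j) \<inter> inside (curve i k) \<noteq> {}"
    have "inside (curve i j) \<inter> curve i k = {}" "inside (curve i k) \<inter> curve i j = {}"
      using disj[of i j k] disj[of i k j] ijk
        inside_no_overlap[of "curve i j"] inside_no_overlap[of "curve i k"] by blast+
    \<comment> \<open>Equal insides have equal frontiers, which are the loops themselves, so
      \<open>m j\<close> would lie on arc \<open>i\<close> or arc \<open>k\<close>.\<close>
    then have "inside (curve i j) = inside (curve i k)"
      by (intro inside_eq_of_meet connected_inside_curve ijk meet)
    then have "curve i j = curve i k"
      using frontier_inside_curve[of i j] frontier_inside_curve[of i k] ijk by metis
    then have "m j \<in> path_image (g j) \<inter> curve i k"
      using m(1)[of j] ijk by auto
    then show False
      using meets[of j i] meets[of j k] m(2)[of j] ijk by auto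
  qed
  obtain z where z: "z \<in> inside (curve 0 1)"
    using inside_curve_nonempty[of 0 1] by auto
  then have "z \<in> inside (curve 0 2) \<or> z \<in> inside (curve 1 2)"
    using disj[of 0 1 2] by (intro inside_curve_cases) auto
  then show False
    using distinct[of 0 1 2] distinct[of 1 0 2] z by (auto simp: Un_commute)
qed

end

subsection \<open>Bipartite graphs drawn on an outer boundary\<close>

lemma nat_indexed_triple:
  assumes "\<not> card A \<le> 2"
  obtains a :: "nat \<Rightarrow> 'a" where "inj_on a {..<3}" "\<And>i. i < 3 \<Longrightarrow> a i \<in> A"
proof -
  obtain T where T: "T \<subseteq> A" "card T = 3" "finite T"
    using obtain_subset_with_card_n[of 3 A] assms by auto
  obtain a :: "nat \<Rightarrow> 'a" where "bij_betw a {0..<3} T"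
    using ex_bij_betw_nat_finite[OF T(3)] T(2) by auto
  with T(1) show ?thesis
    by (intro that[of a]) (auto simp: bij_betw_def lessThan_atLeast0)
qed

lemma third_index:
  assumes "i < 3" "j < 3" "i \<noteq> (j::nat)"
  obtains l where "l < 3" "l \<noteq> i" "l \<noteq> j" "\<And>x. x < 3 \<Longrightarrow> x = i \<or> x = j \<or> x = l"
proof -
  have "i = 0 \<or> i = 1 \<or> i = 2" "j = 0 \<or> j = 1 \<or> j = 2"
    using assms by linarith+
  \<comment> \<open>The indices 0, 1, 2 add up to 3, so \<open>3 - i - j\<close> is the remaining
    one.\<close>
  then show ?thesis
    using that[of "3 - i - j"] assms(3) by (elim disjE) (simp_all, linarith+)
qed

locale bipartite_outer_drawing =
  fixes G :: "'a pair_pre_digraph" and pos :: "'a \<Rightarrow> complex" and crv :: "'a \<times> 'a \<Rightarrow> real \<Rightarrow> complex"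
  assumes graph: "pair_graph G"
    and bipartite: "bipartite G"
    and embedding: "planar_embedding G pos crv"
    and outer: "\<And>v. v \<in> pverts G \<Longrightarrow> pos v \<in> frontier (outside (drawing G pos crv))"
begin

abbreviation V where "V \<equiv> pverts G"
abbreviation E where "E \<equiv> parcs G"

lemma finite_V: "finite V"
  using graph by (auto simp: pair_graph_def pair_digraph_def pair_fin_digraph_def
    pair_fin_digraph_axioms_def)

lemma edge_in_V: "(u, v) \<in> E \<Longrightarrow> u \<in> V" "(u, v) \<in> E \<Longrightarrow> v \<in> V"
  using graph by (auto simp: pair_graph_def pair_digraph_def pair_fin_digraph_def
    pair_wf_digraph_def)

lemma edge_sym: "(u, v) \<in> E \<Longrightarrow> (v, u) \<in> E"
  using graph by (auto simp: pair_graph_def pair_pseudo_graph_def pair_sym_digraph_def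
    pair_sym_digraph_axioms_def Digraph.symmetric_def sym_def)

text \<open>One colour class, kept only through the property that every edge crosses it; this is the
  form used in parity arguments on walks.\<close>

definition side :: "'a set" where
  "side = (SOME U. \<forall>(u, v) \<in> E. u \<in> U \<longleftrightarrow> v \<notin> U)"

lemma edge_side: "(u, v) \<in> E \<Longrightarrow> u \<in> side \<longleftrightarrow> v \<notin> side"
proof -
  obtain U W where "U \<inter> W = {}" "E \<subseteq> U \<times> W \<union> W \<times> U"
    using bipartite unfolding Defs.bipartite_def by blast
  then have "\<forall>(u, v) \<in> E. u \<in> U \<longleftrightarrow> v \<notin> U" by blast
  then have "\<forall>(u, v) \<in> E. u \<in> side \<longleftrightarrow> v \<notin> side"
    unfolding side_def by (rule someI)
  then show "(u, v) \<in> E \<Longrightarrow> u \<in> side \<longleftrightarrow> v \<notin> side" by blast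
qed

lemma no_loop: "(v, v) \<notin> E"
  using edge_side by blast

section \<open>Induced pieces of the drawing, and paths as arcs\<close>

definition span :: "'a set \<Rightarrow> complex set" where
  "span X = pos ` X \<union> (\<Union>e \<in> E \<inter> X \<times> X. path_image (crv e))"

lemma span_subset_drawing: "X \<subseteq> V \<Longrightarrow> span X \<subseteq> drawing G pos crv"
  by (auto simp: span_def drawing_def)

lemma pos_inj: "u \<in> V \<Longrightarrow> v \<in> V \<Longrightarrow> pos u = pos v \<longleftrightarrow> u = v"
  using embedding by (auto simp: planar_embedding_def inj_on_def)

lemma edge_curve:
  assumes "(u, v) \<in> E"
  shows "arc (crv (u, v))" "pathstart (crv (u, v)) = pos u" "pathfinish (crv (u, v)) = pos v"
    "path_image (crv (u, v)) \<inter> pos ` V = {pos u, pos v}"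
  using bspec[OF conjunct1[OF conjunct2[OF embedding[unfolded planar_embedding_def]]] assms]
  by simp_all

lemma edge_curves_meet:
  assumes "(u, v) \<in> E" "(x, y) \<in> E" "{u, v} \<noteq> {x, y}"
  shows "path_image (crv (u, v)) \<inter> path_image (crv (x, y)) \<subseteq> pos ` ({u, v} \<inter> {x, y})"
  using embedding assms unfolding planar_embedding_def by fast

lemma vertex_on_edge:
  assumes "(u, v) \<in> E" "x \<in> V" "pos x \<in> path_image (crv (u, v))"
  shows "x \<in> {u, v}"
proof -
  have "pos x \<in> {pos u, pos v}"
    using edge_curve(4)[OF assms(1)] assms by blast
  then show ?thesis
    using pos_inj edge_in_V assms by blast
qed

text \<open>Curves of different edges meet only at common ends, and a vertex point on a curve is an
  end of that edge. Since \<open>span\<close> takes all edges induced on its argument, intersections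
  in the plane are controlled by vertex sets alone.\<close>

lemma span_Int:
  assumes "X \<subseteq> V" "Y \<subseteq> V"
  shows "span X \<inter> span Y \<subseteq> span (X \<inter> Y)"
proof
  fix z assume z: "z \<in> span X \<inter> span Y"
  consider x where "x \<in> X" "z = pos x"
    | u v where "(u, v) \<in> E" "u \<in> X" "v \<in> X" "z \<in> path_image (crv (u, v))"
    using z by (auto simp: span_def)
  then show "z \<in> span (X \<inter> Y)"
  proof cases
    case x: 1
    consider y where "y \<in> Y" "pos x = pos y"
      | s t where "(s, t) \<in> E" "s \<in> Y" "t \<in> Y" "pos x \<in> path_image (crv (s, t))"
      using z x by (auto simp: span_def)
    then have "x \<in> Y"
    proof cases
      case 1
      then show ?thesis using pos_inj[of x] x assms by auto
    next
      case 2
      then show ?thesis using vertex_on_edge[of _ _ x] x assms by auto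
    qed
    with x show ?thesis by (auto simp: span_def)
  next
    case uv: 2
    consider y where "y \<in> Y" "z = pos y"
      | s t where "(s, t) \<in> E" "s \<in> Y" "t \<in> Y" "z \<in> path_image (crv (s, t))"
      using z by (auto simp: span_def)
    then show ?thesis
    proof cases
      case y: 1
      then have "y \<in> X"
        using uv assms vertex_on_edge[of u v y] by auto
      with y show ?thesis by (auto simp: span_def)
    next
      case st: 2
      show ?thesis
      proof (cases "{u, v} = {s, t}")
        case True
        then have "u \<in> Y" "v \<in> Y" using st by auto
        with uv show ?thesis by (auto simp: span_def)
      next
        case False
        then have "z \<in> pos ` ({u, v} \<inter> {s, t})"
          using edge_curves_meet[OF uv(1) st(1)] uv st by blast
        with uv st show ?thesis by (auto simp: span_def)
      qed
    qed
  qed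
qed

text \<open>\<open>linked X a b\<close>: some path from \<open>a\<close> to \<open>b\<close> has exactly the vertices \<open>X\<close>, expressed via the arc
  that draws it.\<close>

definition linked :: "'a set \<Rightarrow> 'a \<Rightarrow> 'a \<Rightarrow> bool" where
  "linked X a b \<longleftrightarrow> X \<subseteq> V \<and> a \<in> X \<and> b \<in> X \<and>
     (\<exists>g. arc g \<and> pathstart g = pos a \<and> pathfinish g = pos b \<and>
        path_image g \<subseteq> span X \<and> pos ` X \<subseteq> path_image g)"

lemma linked_edge:
  assumes "(a, b) \<in> E"
  shows "linked {a, b} a b"
  unfolding linked_def
  using assms edge_curve[OF assms] edge_in_V[OF assms]
    pathstart_in_path_image[of "crv (a, b)"] pathfinish_in_path_image[of "crv (a, b)"]
  by (intro conjI exI[of _ "crv (a, b)"]) (auto simp: span_def)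

text \<open>The two arcs meet within \<open>span {b}\<close>, a single point because there are no
  loops, so their concatenation is again an arc.\<close>

lemma linked_join:
  assumes "linked X a b" "linked Y b c" "X \<inter> Y = {b}"
  shows "linked (X \<union> Y) a c"
proof -
  obtain g where g: "arc g" "pathstart g = pos a" "pathfinish g = pos b"
    "path_image g \<subseteq> span X" "pos ` X \<subseteq> path_image g"
    using assms(1) by (auto simp: linked_def)
  obtain h where h: "arc h" "pathstart h = pos b" "pathfinish h = pos c"
    "path_image h \<subseteq> span Y" "pos ` Y \<subseteq> path_image h"
    using assms(2) by (auto simp: linked_def)
  have XY: "X \<subseteq> V" "Y \<subseteq> V" "a \<in> X" "c \<in> Y"
    using assms by (auto simp: linked_def)
  have "path_image g \<inter> path_image h \<subseteq> span {b}"
    using span_Int[OF XY(1,2)] g(4) h(4) assms(3) by auto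
  also have "\<dots> = {pos b}"
    using no_loop by (auto simp: span_def)
  finally have "arc (g +++ h)"
    using g h by (intro arc_join) auto
  moreover have "path_image (g +++ h) = path_image g \<union> path_image h"
    using g h by (intro path_image_join) auto
  moreover have "span X \<union> span Y \<subseteq> span (X \<union> Y)"
    by (auto simp: span_def)
  ultimately show ?thesis
    unfolding linked_def using XY g h by (intro conjI exI[of _ "g +++ h"]) auto
qed

text \<open>As \<open>a\<close> and \<open>b\<close> are nonadjacent, \<open>span {a, b}\<close>
  consists of two points, so the three arcs meet only at their ends and form a theta curve. The
  vertices \<open>m i\<close> put an inner point of each arc on the outer boundary.\<close>

lemma no_theta:
  fixes X :: "nat \<Rightarrow> 'a set"
  assumes linked: "\<And>i. i < 3 \<Longrightarrow> linked (X i) a b"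
    and disjoint: "\<And>i j. i < 3 \<Longrightarrow> j < 3 \<Longrightarrow> i \<noteq> j \<Longrightarrow> X i \<inter> X j \<subseteq> {a, b}"
    and inner: "\<And>i. i < 3 \<Longrightarrow> m i \<in> X i - {a, b}"
    and nonadjacent: "(a, b) \<notin> E"
  shows False
proof -
  have "\<exists>h. arc h \<and> pathstart h = pos a \<and> pathfinish h = pos b \<and>
      path_image h \<subseteq> span (X i) \<and> pos ` X i \<subseteq> path_image h" if "i < 3" for i :: nat
    using linked[OF that] by (auto simp: linked_def)
  then obtain g where g: "\<And>i::nat. i < 3 \<Longrightarrow> arc (g i) \<and> pathstart (g i) = pos a \<and>
      pathfinish (g i) = pos b \<and> path_image (g i) \<subseteq> span (X i) \<and> pos ` X i \<subseteq> path_image (g i)"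
    by metis
  have XV: "X i \<subseteq> V" "a \<in> X i" "b \<in> X i" if "i < 3" for i
    using linked[OF that] by (auto simp: linked_def)
  have span_ab: "span {a, b} \<subseteq> {pos a, pos b}"
    using no_loop nonadjacent edge_sym by (auto simp: span_def)
  have meet: "path_image (g i) \<inter> path_image (g j) \<subseteq> {pos a, pos b}"
    if "i < 3" "j < 3" "i \<noteq> j" for i j
  proof -
    have "X i \<inter> X j = {a, b}"
      using disjoint[OF that] XV that by blast
    moreover have "path_image (g i) \<inter> path_image (g j) \<subseteq> span (X i) \<inter> span (X j)"
      using g[of i] g[of j] that by (intro Int_mono) auto
    ultimately show ?thesis
      using span_Int[of "X i" "X j"] XV(1)[of i] XV(1)[of j] that span_ab by auto
  qed
  interpret theta_curve "pos a" "pos b" g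
    by unfold_locales (use g meet in auto)
  show False
  proof (rule not_all_on_outer_boundary[where m = "\<lambda>i. pos (m i)"])
    fix i :: nat assume i: "i < 3"
    have mi: "m i \<in> X i" "m i \<noteq> a" "m i \<noteq> b" "m i \<in> V"
      using inner[OF i] XV[OF i] by auto
    then show "pos (m i) \<in> path_image (g i)"
      using g[OF i] by auto
    have "a \<in> V" "b \<in> V" using XV[OF i] by auto
    then show "pos (m i) \<notin> {pos a, pos b}"
      using mi pos_inj[of "m i"] by simp
    \<comment> \<open>The arcs are part of the drawing, and a smaller set has a larger
      outside.\<close>
    have "(\<Union>i<3. path_image (g i)) \<subseteq> drawing G pos crv"
    proof (rule UN_least)
      fix j :: nat assume "j \<in> {..<3}"
      then show "path_image (g j) \<subseteq> drawing G pos crv"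
        using g[of j] XV(1)[of j] span_subset_drawing[of "X j"] by auto
    qed
    then have "closure (outside (drawing G pos crv)) \<subseteq> closure (outside (\<Union>i<3. path_image (g i)))"
      by (intro closure_mono outside_mono)
    then show "pos (m i) \<in> closure (outside (\<Union>i<3. path_image (g i)))"
      using outer[OF mi(4)] by (auto simp: frontier_def)
  qed
qed

text \<open>Three common neighbours would give three paths of length two from \<open>a\<close> to
  \<open>b\<close>, which are nonadjacent because they lie on the same side.\<close>

lemma card_common_neighbours:
  assumes "a \<noteq> b"
  shows "card {v. (a, v) \<in> E \<and> (b, v) \<in> E} \<le> 2"
proof (rule ccontr)
  assume "\<not> ?thesis"
  then obtain m where inj: "inj_on m {..<3}"
    and m: "\<And>i::nat. i < 3 \<Longrightarrow> m i \<in> {v. (a, v) \<in> E \<and> (b, v) \<in> E}"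
    by (rule nat_indexed_triple) blast
  show False
  proof (rule no_theta[where X = "\<lambda>i. {a, m i} \<union> {m i, b}" and m = m and a = a and b = b])
    fix i :: nat assume i: "i < 3"
    then show "linked ({a, m i} \<union> {m i, b}) a b"
      using m[OF i] assms edge_sym no_loop by (intro linked_join[of _ _ "m i"] linked_edge) auto
    show "m i \<in> {a, m i} \<union> {m i, b} - {a, b}"
      using m[OF i] no_loop by auto
  next
    fix i j :: nat assume "i < 3" "j < 3" "i \<noteq> j"
    then show "({a, m i} \<union> {m i, b}) \<inter> ({a, m j} \<union> {m j, b}) \<subseteq> {a, b}"
      using inj by (auto simp: inj_on_def)
  next
    show "(a, b) \<notin> E"
      using m[of 0] edge_side[of a "m 0"] edge_side[of b "m 0"] edge_side[of a b] by auto
  qed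
qed

section \<open>Breadth-first layers and the edge count\<close>

definition root :: "'a \<Rightarrow> 'a" where
  "root v = (SOME r. (r, v) \<in> E\<^sup>*)"

definition level :: "'a \<Rightarrow> nat" where
  "level v = (LEAST k. (root v, v) \<in> E ^^ k)"

lemma level_relpow: "(root v, v) \<in> E ^^ level v"
proof -
  have "(root v, v) \<in> E\<^sup>*"
    unfolding root_def by (rule someI[of _ v]) simp
  then show ?thesis
    unfolding level_def by (metis rtrancl_power LeastI)
qed

text \<open>By symmetry of \<open>E\<close> the same vertices reach \<open>v\<close> and
  \<open>w\<close>, so the choice operator is applied to equal predicates. Hence \<open>root\<close>
  picks one vertex per component.\<close>

lemma root_edge: "(v, w) \<in> E \<Longrightarrow> root v = root w"
proof -
  assume vw: "(v, w) \<in> E"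
  have "(r, v) \<in> E\<^sup>* \<longleftrightarrow> (r, w) \<in> E\<^sup>*" for r
    using vw edge_sym[OF vw] by (meson rtrancl.rtrancl_into_rtrancl)
  then show ?thesis by (simp add: root_def)
qed

lemma level_edge_le: "(v, w) \<in> E \<Longrightarrow> level w \<le> Suc (level v)"
  using level_relpow[of v] root_edge[of v w] unfolding level_def[of w]
  by (intro Least_le) auto

lemma relpow_side: "(v, w) \<in> E ^^ k \<Longrightarrow> (v \<in> side \<longleftrightarrow> w \<in> side) \<longleftrightarrow> even k"
  by (induction k arbitrary: w) (auto dest: edge_side)

text \<open>The parity of the level tells whether a vertex is on the side of its root, so adjacent
  vertices have different levels. They differ by at most one because walks from the root extend
  along the edge.\<close>

lemma level_edge: "(v, w) \<in> E \<Longrightarrow> level w = Suc (level v) \<or> level v = Suc (level w)"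
proof -
  assume vw: "(v, w) \<in> E"
  have "level v \<noteq> level w"
    using relpow_side[OF level_relpow[of v]] relpow_side[OF level_relpow[of w]]
      edge_side[OF vw] root_edge[OF vw] by auto
  then show ?thesis
    using level_edge_le[OF vw] level_edge_le[OF edge_sym[OF vw]] by linarith
qed

lemma level_0: "level v = 0 \<Longrightarrow> root v = v"
  using level_relpow[of v] by simp

lemma parent_exists:
  assumes "level v = Suc k"
  obtains p where "(v, p) \<in> E" "level p = k" "root p = root v"
proof -
  obtain p where p: "(root v, p) \<in> E ^^ k" "(p, v) \<in> E"
    using level_relpow[of v] assms by auto
  have "level p \<le> k"
    using p root_edge[OF p(2)] unfolding level_def by (intro Least_le) simp
  then show ?thesis
    using that[of p] p edge_sym[OF p(2)] level_edge[OF p(2)] root_edge[OF p(2)] assms by auto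
qed

text \<open>Pass from \<open>b\<close> and \<open>c\<close> to parents \<open>p\<close> and
  \<open>q\<close>: either these coincide, or the induction hypothesis joins them through lower
  levels. At level 0 both vertices would be the root.\<close>

lemma linked_below:
  assumes "level b = k" "level c = k" "b \<noteq> c" "root b = root c"
  shows "\<exists>X. linked X b c \<and> X \<subseteq> {b, c} \<union> {v. level v < k}"
  using assms
proof (induction k arbitrary: b c)
  case 0
  then show ?case using level_0 by metis
next
  case (Suc k)
  obtain p where p: "(b, p) \<in> E" "level p = k" "root p = root b"
    using Suc.prems(1) by (rule parent_exists)
  obtain q where q: "(c, q) \<in> E" "level q = k" "root q = root c"
    using Suc.prems(2) by (rule parent_exists)
  have bp: "linked {b, p} b p" and qc: "linked {q, c} q c"
    using p q by (auto intro: linked_edge edge_sym)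
  show ?case
  proof (cases "p = q")
    case True
    have "linked ({b, p} \<union> {q, c}) b c"
      using bp qc True Suc.prems p q by (intro linked_join[of _ _ p]) auto
    then show ?thesis
      using p q True by (intro exI[of _ "{b, p} \<union> {q, c}"]) auto
  next
    case False
    then obtain X where X: "linked X p q" "X \<subseteq> {p, q} \<union> {v. level v < k}"
      using Suc.IH[of p q] p q Suc.prems by auto
    have pq: "p \<in> X" "q \<in> X" using X(1) by (auto simp: linked_def)
    have "level v \<le> k" if "v \<in> X" for v
      using X(2) that p(2) q(2) by auto
    then have "b \<notin> X" "c \<notin> X"
      using Suc.prems by fastforce+
    moreover have "b \<noteq> q" using Suc.prems q by auto
    ultimately have meets: "{b, p} \<inter> X = {p}" "({b, p} \<union> X) \<inter> {q, c} = {q}"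
      using pq Suc.prems(3) False p(1,2) Suc.prems(2) by auto
    have "linked (({b, p} \<union> X) \<union> {q, c}) b c"
      by (rule linked_join[OF linked_join[OF bp X(1) meets(1)] qc meets(2)])
    moreover have "({b, p} \<union> X) \<union> {q, c} \<subseteq> {b, c} \<union> {v. level v < Suc k}"
      using X(2) p q by auto
    ultimately show ?thesis by blast
  qed
qed

text \<open>A claw from \<open>w\<close> to three vertices of one level is extended towards the root until two of its
  legs merge; there it closes up to a theta graph.\<close>

lemma no_claw_above:
  fixes a :: "nat \<Rightarrow> 'a" and Y :: "nat \<Rightarrow> 'a set"
  assumes "\<And>i. i < 3 \<Longrightarrow> level (a i) = k" "\<And>i. i < 3 \<Longrightarrow> root (a i) = r" "inj_on a {..<3}"
    and "\<And>i. i < 3 \<Longrightarrow> linked (Y i) w (a i)"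
    and "\<And>i v. i < 3 \<Longrightarrow> v \<in> Y i \<Longrightarrow> level v \<le> k \<Longrightarrow> v = a i"
    and "\<And>i j. i < 3 \<Longrightarrow> j < 3 \<Longrightarrow> i \<noteq> j \<Longrightarrow> Y i \<inter> Y j = {w}"
    and "k < level w"
  shows False
  using assms
proof (induction k arbitrary: a Y)
  case 0
  have "a 0 = a 1"
    using level_0 0(1)[of 0] 0(1)[of 1] 0(2)[of 0] 0(2)[of 1] by simp
  then show ?case using inj_onD[OF 0(3), of 0 1] by simp
next
  case (Suc k)
  note a = Suc.prems
  have "\<exists>p. (a i, p) \<in> E \<and> level p = k \<and> root p = r" if i: "i < 3" for i
    by (rule parent_exists[OF a(1)[OF i]]) (use a(2)[OF i] in auto)
  then obtain p where p: "\<And>i. i < 3 \<Longrightarrow> (a i, p i) \<in> E \<and> level (p i) = k \<and> root (p i) = r"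
    by metis
  \<comment> \<open>Each leg grows by a parent of its end. Parents have level \<open>k\<close>,
    while \<open>a j\<close> at level \<open>Suc k\<close> is the lowest vertex of its leg, so a
    parent is new to every leg.\<close>
  define W where "W i = Y i \<union> {a i, p i}" for i
  have pY: "p i \<notin> Y j" if "i < 3" "j < 3" for i j
  proof
    assume "p i \<in> Y j"
    then have "p i = a j" using a(5)[OF that(2)] p[OF that(1)] by simp
    then show False using p[OF that(1)] a(1)[OF that(2)] by simp
  qed
  have aY: "a i \<in> Y i" "w \<in> Y i" if "i < 3" for i
    using a(4)[OF that] by (auto simp: linked_def)
  have W_eq: "W i = insert (p i) (Y i)" if "i < 3" for i
    using aY[OF that] by (auto simp: W_def)
  have W: "linked (W i) w (p i)" if "i < 3" for i
    unfolding W_def using a(4)[OF that] aY[OF that] pY[OF that that] p[OF that]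
    by (intro linked_join[of _ _ "a i"] linked_edge) auto
  have W_low: "v = p i" if "i < 3" "v \<in> W i" "level v \<le> k" for i v
    using that a(1)[OF that(1)] a(5)[OF that(1), of v] unfolding W_eq[OF that(1)] by fastforce
  have W_meet: "W i \<inter> W j = (if p i = p j then {w, p i} else {w})"
    if "i < 3" "j < 3" "i \<noteq> j" for i j
    using a(6)[OF that] pY[of i j] pY[of j i] that by (auto simp: W_eq)
  have a_inner: "a i \<in> W i - {w, p j}" if "i < 3" "j < 3" for i j
    using aY[OF that(1)] a(1)[OF that(1)] a(7) p[OF that(2)] by (auto simp: W_def)
  \<comment> \<open>\<open>w\<close> has level at least \<open>k + 2\<close>, so it is not adjacent
    to level \<open>k\<close>; this is the nonadjacency that \<open>no_theta\<close> asks
    for.\<close>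
  have nonadj: "(w, p i) \<notin> E" if "i < 3" for i
    using p[OF that] a(7) level_edge[of w "p i"] by auto
  show ?case
  proof (cases "inj_on p {..<3}")
    case True
    show ?thesis
    proof (rule Suc.IH[of p W])
      fix i j :: nat assume ij: "i < 3" "j < 3" "i \<noteq> j"
      have "p i \<noteq> p j" using True ij by (auto simp: inj_on_def)
      then show "W i \<inter> W j = {w}" using W_meet[OF ij] by simp
    qed (use True p W W_low a(7) in auto)
  next
    case False
    then obtain i j where ij: "i < 3" "j < 3" "i \<noteq> j" "p i = p j"
      by (auto simp: inj_on_def)
    obtain l where l: "l < 3" "l \<noteq> i" "l \<noteq> j" and cases3: "\<And>x. x < 3 \<Longrightarrow> x = i \<or> x = j \<or> x = l"
      using third_index[OF ij(1-3)] by blast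
    show ?thesis
    proof (cases "p l = p i")
      case True
      then have all: "p x = p i" if "x < 3" for x
        using cases3[OF that] ij by auto
      show ?thesis
      proof (rule no_theta[of W w "p i" a])
        fix x :: nat assume x: "x < 3"
        show "linked (W x) w (p i)" using W[OF x] all[OF x] by simp
        show "a x \<in> W x - {w, p i}" using a_inner x ij by blast
      next
        fix x y :: nat assume "x < 3" "y < 3" "x \<noteq> y"
        then show "W x \<inter> W y \<subseteq> {w, p i}" using W_meet[of x y] all by auto
      qed (use nonadj ij in auto)
    next
      case False
      then obtain Z where Z: "linked Z (p l) (p i)" "Z \<subseteq> {p l, p i} \<union> {v. level v < k}"
        using linked_below[of "p l" k "p i"] p[of l] p[of i] l ij by auto
      have Z_low: "Z \<subseteq> {v. level v \<le> k}"
        using Z(2) p[of l] p[of i] l ij by auto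
      have pZ: "p l \<in> Z" using Z(1) by (auto simp: linked_def)
      have WlZ: "W l \<inter> Z = {p l}"
        using W_low[OF l(1)] Z_low pZ W_eq[OF l(1)] by blast
      have pz: "p x = p i" if "x < 3" "x \<noteq> l" for x
        using cases3[OF that(1)] that ij by auto
      have WxZ: "W x \<inter> Z \<subseteq> {p i}" if "x < 3" "x \<noteq> l" for x
        using W_low[OF that(1)] Z_low pz[OF that] by blast
      \<comment> \<open>Only the legs other than \<open>l\<close> have reached \<open>p i\<close>.
        Leg \<open>l\<close> is continued by the path \<open>Z\<close> from \<open>p l\<close>,
        which stays at levels up to \<open>k\<close> and so meets the other legs at most in
        \<open>p i\<close>.\<close>
      define X where "X x = (if x = l then W l \<union> Z else W x)" for x
      show ?thesis
      proof (rule no_theta[of X w "p i" a])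
        fix x :: nat assume x: "x < 3"
        show "linked (X x) w (p i)"
        proof (cases "x = l")
          case True
          then show ?thesis
            using linked_join[OF W[OF l(1)] Z(1) WlZ] by (simp add: X_def)
        next
          case False
          then show ?thesis
            using W[OF x] pz[OF x] by (simp add: X_def)
        qed
        show "a x \<in> X x - {w, p i}" using a_inner[OF x ij(1)] by (auto simp: X_def)
      next
        fix x y :: nat assume xy: "x < 3" "y < 3" "x \<noteq> y"
        have "W x \<inter> W y \<subseteq> {w, p i}"
          using W_meet[OF xy] pz[OF xy(1)] pz[OF xy(2)] xy by (cases "x = l") auto
        then show "X x \<inter> X y \<subseteq> {w, p i}"
          using WxZ[OF xy(1)] WxZ[OF xy(2)] xy by (auto simp: X_def)
      qed (use nonadj ij in auto)
    qed
  qed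
qed

text \<open>Three such neighbours all lie exactly one level below \<open>w\<close>, and their edges
  to \<open>w\<close> form the claw refuted by \<open>no_claw_above\<close>.\<close>

lemma card_lower_neighbours: "card {u. (w, u) \<in> E \<and> level u < level w} \<le> 2"
proof (rule ccontr)
  assume "\<not> ?thesis"
  then obtain a where inj: "inj_on a {..<3}"
    and a: "\<And>i::nat. i < 3 \<Longrightarrow> a i \<in> {u. (w, u) \<in> E \<and> level u < level w}"
    by (rule nat_indexed_triple) blast
  have level_w: "level w = Suc (level (a i))" if "i < 3" for i
    using a[OF that] level_edge[of w "a i"] by auto
  show False
  proof (rule no_claw_above[of a "level w - 1" "root w" "\<lambda>i. {w, a i}" w])
    fix i :: nat assume i: "i < 3"
    show "level (a i) = level w - 1" using level_w[OF i] by simp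
    show "root (a i) = root w" using root_edge[of w "a i"] a[OF i] by simp
    show "linked {w, a i} w (a i)" using a[OF i] by (auto intro: linked_edge)
    show "v = a i" if "v \<in> {w, a i}" "level v \<le> level w - 1" for v
      using level_w[OF i] that by auto
  next
    fix i j :: nat assume ij: "i < 3" "j < 3" "i \<noteq> j"
    then show "{w, a i} \<inter> {w, a j} = {w}"
      using inj by (auto simp: inj_on_def)
  next
    show "level w - 1 < level w" using level_w[of 0] by simp
  qed (use inj in auto)
qed

text \<open>Each edge is charged to its upper end, at most two per vertex; the factor is 4 because
  \<open>E\<close> contains both arcs of each edge.\<close>

lemma card_edges: "card E \<le> 4 * card V"
proof -
  define D where "D = (SIGMA w:V. {u. (w, u) \<in> E \<and> level u < level w})"
  have fin: "finite {u. (w, u) \<in> E \<and> level u < level w}" for w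
    using edge_in_V by (intro finite_subset[OF _ finite_V]) blast
  have "finite D"
    unfolding D_def using finite_V fin by auto
  have "card D = (\<Sum>w\<in>V. card {u. (w, u) \<in> E \<and> level u < level w})"
    unfolding D_def using finite_V fin by simp
  also have "\<dots> \<le> (\<Sum>w\<in>V. 2)"
    by (intro sum_mono card_lower_neighbours)
  finally have "card D \<le> 2 * card V" by simp
  have "E \<subseteq> D \<union> D\<inverse>"
  proof
    fix e assume "e \<in> E"
    moreover obtain v w where "e = (v, w)" by fastforce
    ultimately show "e \<in> D \<union> D\<inverse>"
      using level_edge[of v w] edge_in_V[of v w] edge_sym[of v w] by (auto simp: D_def)
  qed
  then have "card E \<le> card (D \<union> D\<inverse>)"
    using \<open>finite D\<close> by (intro card_mono) auto
  also have "\<dots> \<le> card D + card (D\<inverse>)" by (rule card_Un_le)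
  also have "\<dots> \<le> 4 * card V"
    using \<open>card D \<le> 2 * card V\<close> by simp
  finally show ?thesis .
qed

end

subsection \<open>Eigenvalues of sparse graphs with few common neighbours\<close>

text \<open>The assumption on \<open>\<mu>\<close> is an inequality so as to admit the absolute
  values of an eigenvector, for which the triangle inequality is all that remains of the
  equation.\<close>

lemma normalized_spectral_bound:
  fixes E :: "('a \<times> 'a) set" and x :: "'a \<Rightarrow> real" and \<mu> :: real
  assumes V: "finite V" "E \<subseteq> V \<times> V" "card V > 344569"
    and sym: "\<And>a b. (a, b) \<in> E \<Longrightarrow> (b, a) \<in> E"
    and triangle_free: "\<And>a b v. (a, v) \<in> E \<Longrightarrow> (b, v) \<in> E \<Longrightarrow> (a, b) \<notin> E"
    and codegree: "\<And>a b. a \<noteq> b \<Longrightarrow> card {v. (a, v) \<in> E \<and> (b, v) \<in> E} \<le> 2"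
    and edges: "card E \<le> 4 * card V"
    and x: "\<And>v. v \<in> V \<Longrightarrow> 0 \<le> x v" "\<And>v. v \<in> V \<Longrightarrow> x v \<le> 1"
    and u: "u \<in> V" "x u = 1"
    and \<mu>: "0 \<le> \<mu>" "\<And>v. v \<in> V \<Longrightarrow> \<mu> * x v \<le> (\<Sum>w \<in> E `` {v}. x w)"
  shows "\<mu>\<^sup>2 \<le> card V - 1"
proof (rule ccontr)
  define n where "n = card V"
  have n: "344569 < n" using V(3) by (simp add: n_def)
  assume "\<not> ?thesis"
  then have big: "real n - 1 < \<mu>\<^sup>2"
    using n by (simp add: n_def of_nat_diff)
  \<comment> \<open>The threshold is \<open>344569 = 587\<^sup>2\<close>; as \<open>n\<close>
    exceeds it, \<open>n - 1\<close> is still at least \<open>587\<^sup>2\<close>.\<close>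
  have "587\<^sup>2 < \<mu>\<^sup>2"
    using big n by simp
  then have \<mu>_big: "587 < \<mu>"
    using \<mu>(1) by (rule power2_less_imp_less)
  define N where "N v = E `` {v}" for v
  define c where "c a b = card (N a \<inter> N b)" for a b
  have N_V: "N v \<subseteq> V" for v using V(2) by (auto simp: N_def)
  have fin_N: "finite (N v)" for v using N_V V(1) by (rule finite_subset)
  have N_iff: "w \<in> N v \<longleftrightarrow> v \<in> N w" for v w
    using sym by (auto simp: N_def)
  have c_le: "c a b \<le> 2" if "a \<noteq> b" for a b
  proof -
    have "N a \<inter> N b = {v. (a, v) \<in> E \<and> (b, v) \<in> E}" by (auto simp: N_def)
    then show ?thesis using codegree[OF that] by (simp add: c_def)
  qed
  define S where "S = (\<Sum>v\<in>V. x v)"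
  have "0 \<le> S" unfolding S_def using x(1) by (rule sum_nonneg)
  have "\<mu> * S = (\<Sum>v\<in>V. \<mu> * x v)" by (simp add: S_def sum_distrib_left)
  also have "\<dots> \<le> (\<Sum>v\<in>V. \<Sum>w\<in>N v. x w)"
    using \<mu>(2) by (auto simp: N_def intro: sum_mono)
  also have "\<dots> \<le> (\<Sum>v\<in>V. \<Sum>w\<in>N v. 1)"
    using x(2) N_V by (intro sum_mono) blast
  also have "\<dots> = real (card (SIGMA v:V. N v))"
    using V(1) fin_N by simp
  also have "(SIGMA v:V. N v) = E"
    using V(2) by (auto simp: N_def)
  also have "real (card E) \<le> 4 * real n"
    using edges by (simp add: n_def)
  finally have "\<mu> * S \<le> 4 * real n" .
  moreover have "587 * S \<le> \<mu> * S"
    using \<mu>_big \<open>0 \<le> S\<close> by (intro mult_right_mono) auto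
  \<comment> \<open>The two facts give \<open>587 * S \<le> 4 * n\<close>; the round factor 100 is
    below \<open>587 / 4\<close> and suffices for the estimates that follow.\<close>
  ultimately have S: "100 * S \<le> real n" using \<open>0 \<le> S\<close> by linarith
  \<comment> \<open>Walks of length two from \<open>a\<close> are grouped by their end:
    \<open>card (N a)\<close> of them return to \<open>a\<close>, and \<open>c a w\<close> end at
    \<open>w\<close>.\<close>
  have square: "\<mu>\<^sup>2 * x a \<le> card (N a) * x a + (\<Sum>w\<in>V - {a}. c a w * x w)" if a: "a \<in> V" for a
  proof -
    have "\<mu>\<^sup>2 * x a = \<mu> * (\<mu> * x a)" by (simp add: power2_eq_square)
    also have "\<dots> \<le> \<mu> * (\<Sum>v\<in>N a. x v)"
      using \<mu>(2)[OF a] \<mu>(1) by (auto simp: N_def intro: mult_left_mono)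
    also have "\<dots> = (\<Sum>v\<in>N a. \<mu> * x v)" by (simp add: sum_distrib_left)
    also have "\<dots> \<le> (\<Sum>v\<in>N a. \<Sum>w\<in>N v. x w)"
      using \<mu>(2) N_V unfolding N_def by (intro sum_mono) blast
    also have "\<dots> = (\<Sum>v\<in>N a. \<Sum>w | w \<in> V \<and> w \<in> N v. x w)"
      using N_V by (intro sum.cong refl) auto
    also have "\<dots> = (\<Sum>w\<in>V. \<Sum>v | v \<in> N a \<and> w \<in> N v. x w)"
      using fin_N V(1) by (rule sum.swap_restrict)
    also have "\<dots> = (\<Sum>w\<in>V. c a w * x w)"
    proof (intro sum.cong refl)
      fix w
      have "{v. v \<in> N a \<and> w \<in> N v} = N a \<inter> N w" using N_iff by blast
      then show "(\<Sum>v | v \<in> N a \<and> w \<in> N v. x w) = c a w * x w" by (simp add: c_def)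
    qed
    also have "\<dots> = card (N a) * x a + (\<Sum>w\<in>V - {a}. c a w * x w)"
      using V(1) a by (simp add: sum.remove c_def)
    finally show ?thesis .
  qed
  have rough: "\<mu>\<^sup>2 * x a \<le> card (N a) * x a + 2 * S" if a: "a \<in> V" for a
  proof -
    have "(\<Sum>w\<in>V - {a}. c a w * x w) \<le> (\<Sum>w\<in>V - {a}. 2 * x w)"
      using c_le[of a] x(1) by (intro sum_mono mult_right_mono) auto
    also have "\<dots> \<le> (\<Sum>w\<in>V. 2 * x w)"
      using V(1) x(1) by (intro sum_mono2) auto
    finally show ?thesis using square[OF a] by (simp add: S_def sum_distrib_left)
  qed
  have deg_u: "real n - 1 < card (N u) + 2 * S"
    using rough[OF u(1)] u(2) big by simp
  have small: "x w \<le> 1 / 2" if w: "w \<in> V" "w \<noteq> u" for w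
  proof (rule ccontr)
    assume "\<not> x w \<le> 1 / 2"
    have "card (N u) + card (N w) = card (N u \<union> N w) + c u w"
      unfolding c_def by (rule card_Un_Int) (rule fin_N)+
    also have "\<dots> \<le> n + 2"
      using card_mono[OF V(1), of "N u \<union> N w"] N_V c_le w(2) unfolding n_def
      by (intro add_mono) auto
    finally have "real (card (N u)) + real (card (N w)) \<le> real n + 2" by linarith
    \<comment> \<open>Here \<open>card (N w) < 3 + 2 * S\<close>, so the claim follows from
      \<open>6 * S + 4 \<le> n\<close>. Multiplied by \<open>x w > 1 / 2\<close> it exceeds the
      \<open>2 * S\<close> allowed by \<open>rough\<close>.\<close>
    with deg_u big S n have "4 * S < \<mu>\<^sup>2 - card (N w)" by linarith
    then have "4 * S * (1 / 2) < (\<mu>\<^sup>2 - card (N w)) * x w"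
      using \<open>\<not> x w \<le> 1 / 2\<close> \<open>0 \<le> S\<close> by (intro mult_strict_mono) auto
    then show False
      using rough[OF w(1)] by (simp add: algebra_simps)
  qed
  \<comment> \<open>These are the vertices at distance two from \<open>u\<close>: without triangles
    none of them is a neighbour of \<open>u\<close>.\<close>
  define R where "R = {w \<in> V - {u}. c u w \<noteq> 0}"
  have "(\<Sum>w\<in>V - {u}. c u w * x w) \<le> (\<Sum>w\<in>V - {u}. if c u w \<noteq> 0 then 1 else 0)"
  proof (rule sum_mono)
    fix w assume w: "w \<in> V - {u}"
    \<comment> \<open>At most two common neighbours, times a weight of at most one half: each vertex
      of \<open>R\<close> contributes at most 1.\<close>
    then have "real (c u w) * x w \<le> 2 * (1 / 2)"
      using c_le[of u w] small[of w] x(1)[of w] by (intro mult_mono) auto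
    then show "c u w * x w \<le> (if c u w \<noteq> 0 then 1 else 0)" by simp
  qed
  also have "\<dots> = real (card R)"
    using V(1) by (simp add: R_def sum.If_cases Int_def)
  finally have "\<mu>\<^sup>2 \<le> card (N u) + card R"
    using square[OF u(1)] u(2) by simp
  moreover have "card (N u) + card R \<le> n - 1"
  proof -
    have "v \<notin> R" if "v \<in> N u" for v
    proof
      assume "v \<in> R"
      then have "N u \<inter> N v \<noteq> {}" by (auto simp: R_def c_def)
      then obtain z where "z \<in> N u \<inter> N v" by blast
      then show False using that triangle_free[of u z v] by (auto simp: N_def)
    qed
    then have "N u \<inter> R = {}" by blast
    moreover have "finite R" using V(1) by (simp add: R_def)
    ultimately have "card (N u) + card R = card (N u \<union> R)"
      using fin_N by (intro card_Un_disjoint[symmetric])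
    also have "\<dots> \<le> card (V - {u})"
    proof (rule card_mono)
      have "u \<notin> N u" using triangle_free[of u u u] by (auto simp: N_def)
      then show "N u \<union> R \<subseteq> V - {u}" using N_V by (auto simp: R_def)
    qed (use V(1) in auto)
    finally show ?thesis using u(1) V(1) by (simp add: n_def)
  qed
  then have "card (N u) + card R + 1 \<le> n" using n by linarith
  then have "real (card (N u) + card R + 1) \<le> real n" by (rule of_nat_mono)
  ultimately show False using big by simp
qed

text \<open>Taking absolute values of \<open>\<mu>\<close> and \<open>x\<close> and dividing by the
  largest entry \<open>M\<close> reduces this to the normalized case, by the triangle
  inequality.\<close>

lemma spectral_bound:
  fixes E :: "('a \<times> 'a) set" and x :: "'a \<Rightarrow> real" and \<mu> :: real
  assumes V: "finite V" "E \<subseteq> V \<times> V" "card V > 344569"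
    and sym: "\<And>a b. (a, b) \<in> E \<Longrightarrow> (b, a) \<in> E"
    and triangle_free: "\<And>a b v. (a, v) \<in> E \<Longrightarrow> (b, v) \<in> E \<Longrightarrow> (a, b) \<notin> E"
    and codegree: "\<And>a b. a \<noteq> b \<Longrightarrow> card {v. (a, v) \<in> E \<and> (b, v) \<in> E} \<le> 2"
    and edges: "card E \<le> 4 * card V"
    and x: "\<exists>v\<in>V. x v \<noteq> 0"
    and \<mu>: "\<And>v. v \<in> V \<Longrightarrow> \<mu> * x v = (\<Sum>w \<in> E `` {v}. x w)"
  shows "\<mu>\<^sup>2 \<le> card V - 1"
proof -
  define M where "M = Max ((\<lambda>v. \<bar>x v\<bar>) ` V)"
  have M_ge: "\<bar>x v\<bar> \<le> M" if "v \<in> V" for v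
    unfolding M_def using V(1) that by (intro Max_ge) auto
  have "M \<in> (\<lambda>v. \<bar>x v\<bar>) ` V"
    unfolding M_def using V(1) x by (intro Max_in) auto
  then obtain u where u: "u \<in> V" "\<bar>x u\<bar> = M" by auto
  have "0 < M" using x M_ge by fastforce
  have "\<bar>\<mu>\<bar>\<^sup>2 \<le> card V - 1"
  proof (rule normalized_spectral_bound[OF V sym triangle_free codegree edges])
    fix v assume v: "v \<in> V"
    have "\<bar>\<mu>\<bar> * \<bar>x v\<bar> = \<bar>\<Sum>w \<in> E `` {v}. x w\<bar>"
      using \<mu>[OF v] by (simp add: abs_mult[symmetric])
    also have "\<dots> \<le> (\<Sum>w \<in> E `` {v}. \<bar>x w\<bar>)" by (rule sum_abs)
    finally show "\<bar>\<mu>\<bar> * (\<bar>x v\<bar> / M) \<le> (\<Sum>w \<in> E `` {v}. \<bar>x w\<bar> / M)"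
      using \<open>0 < M\<close> by (simp add: sum_divide_distrib[symmetric] divide_right_mono)
  qed (use u M_ge \<open>0 < M\<close> in auto)
  then show ?thesis by simp
qed

subsection \<open>Spectra of adjacency matrices\<close>

lemma adjacency_matrix_mult_vec:
  assumes "distinct vs" "set vs = pverts G" "parcs G \<subseteq> pverts G \<times> pverts G" "i < length vs"
  shows "vec_index (adjacency_matrix G vs *\<^sub>v vec (length vs) (\<lambda>i. x (vs ! i))) i =
    (\<Sum>w \<in> parcs G `` {vs ! i}. x w)"
proof -
  have bij: "bij_betw ((!) vs) {0..<length vs} (pverts G)"
    using bij_betw_nth[OF assms(1)] assms(2) by (auto simp: lessThan_atLeast0)
  have fin: "finite (pverts G)" using assms(2) by (metis List.finite_set)
  have "vec_index (adjacency_matrix G vs *\<^sub>v vec (length vs) (\<lambda>i. x (vs ! i))) i =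
      (\<Sum>j = 0..<length vs. (if (vs ! i, vs ! j) \<in> parcs G then 1 else 0) * x (vs ! j))"
    using assms(4) by (simp add: adjacency_matrix_def scalar_prod_def)
  also have "\<dots> = (\<Sum>w\<in>pverts G. (if (vs ! i, w) \<in> parcs G then 1 else 0) * x w)"
    by (rule sum.reindex_bij_betw[OF bij])
  also have "\<dots> = (\<Sum>w \<in> parcs G `` {vs ! i}. x w)"
    using fin assms(3) by (intro sum.mono_neutral_cong_right) auto
  finally show ?thesis .
qed

text \<open>Vectors indexed by positions in \<open>vs\<close> correspond to functions on the
  vertices, which removes the enumeration from the eigenvalue equation.\<close>

lemma spectrum_adjacency_matrix_iff:
  assumes "distinct vs" "set vs = pverts G" "parcs G \<subseteq> pverts G \<times> pverts G"
  shows "k \<in> spectrum (adjacency_matrix G vs) \<longleftrightarrow>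
    (\<exists>x. (\<exists>v\<in>pverts G. x v \<noteq> 0) \<and> (\<forall>v\<in>pverts G. k * x v = (\<Sum>w \<in> parcs G `` {v}. x w)))"
    (is "_ \<longleftrightarrow> ?R")
proof
  let ?n = "length vs" and ?A = "adjacency_matrix G vs"
  let ?y = "\<lambda>x. vec ?n (\<lambda>i. x (vs ! i))"
  have dim: "?A \<in> carrier_mat ?n ?n" by (simp add: adjacency_matrix_def)
  have nth_vs: "v \<in> pverts G \<longleftrightarrow> (\<exists>i<?n. v = vs ! i)" for v
    using in_set_conv_nth[of v vs] unfolding assms(2) by metis
  have nonzero: "?y x \<noteq> 0\<^sub>v ?n \<longleftrightarrow> (\<exists>v\<in>pverts G. x v \<noteq> 0)" for x :: "'a \<Rightarrow> real"
    unfolding vec_eq_iff Bex_def nth_vs by auto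
  have eigen: "?A *\<^sub>v ?y x = k \<cdot>\<^sub>v ?y x \<longleftrightarrow>
      (\<forall>v\<in>pverts G. k * x v = (\<Sum>w \<in> parcs G `` {v}. x w))" for x
  proof -
    have "?A *\<^sub>v ?y x = k \<cdot>\<^sub>v ?y x \<longleftrightarrow>
        (\<forall>i<?n. vec_index (?A *\<^sub>v ?y x) i = k * x (vs ! i))"
      using dim unfolding vec_eq_iff by (simp del: index_mult_mat_vec)
    also have "\<dots> \<longleftrightarrow> (\<forall>i<?n. k * x (vs ! i) = (\<Sum>w \<in> parcs G `` {vs ! i}. x w))"
      using adjacency_matrix_mult_vec[OF assms, of _ x] by (metis (lifting))
    finally show ?thesis
      unfolding Ball_def nth_vs by blast
  qed
  have spec: "k \<in> spectrum ?A \<longleftrightarrow> (\<exists>y \<in> carrier_vec ?n. y \<noteq> 0\<^sub>v ?n \<and> ?A *\<^sub>v y = k \<cdot>\<^sub>v y)"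
    using dim unfolding spectrum_def eigenvalue_def eigenvector_def by auto
  show "?R \<Longrightarrow> k \<in> spectrum ?A"
    unfolding spec by (metis nonzero eigen vec_carrier)
  assume "k \<in> spectrum ?A"
  then obtain y where y: "y \<in> carrier_vec ?n" "y \<noteq> 0\<^sub>v ?n" "?A *\<^sub>v y = k \<cdot>\<^sub>v y"
    unfolding spec by blast
  define x where "x v = vec_index y (inv_into {..<?n} ((!) vs) v)" for v
  have "?y x = y"
    using y(1) assms(1) by (auto simp: vec_eq_iff x_def inj_on_nth inv_into_f_f)
  then show ?R
    using y nonzero[of x] eigen[of x] by (intro exI[of _ x]) auto
qed

text \<open>This makes the \<open>Max\<close> in \<open>\<rho>\<close> meaningful. A complex
  eigenvalue exists; symmetry forces it to be real, and being a root of the characteristic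
  polynomial transfers back to the reals.\<close>

lemma symmetric_spectrum_nonempty:
  fixes A :: "real mat"
  assumes A: "A \<in> carrier_mat n n" "0 < n"
    and sym: "\<And>i j. i < n \<Longrightarrow> j < n \<Longrightarrow> A $$ (i, j) = A $$ (j, i)"
  shows "spectrum A \<noteq> {}"
proof -
  let ?B = "map_mat complex_of_real A"
  have B: "?B \<in> carrier_mat n n" using A(1) by simp
  obtain k where k: "k \<in> spectrum ?B"
    using spectrum_non_empty[OF B A(2)] by blast
  then obtain v where v: "v \<in> carrier_vec n" "v \<noteq> 0\<^sub>v n" "?B *\<^sub>v v = k \<cdot>\<^sub>v v"
    using A(1) unfolding spectrum_def eigenvalue_def eigenvector_def by auto
  have row: "(\<Sum>j<n. of_real (A $$ (i, j)) * vec_index v j) = k * vec_index v i" if "i < n" for i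
    using arg_cong[OF v(3), of "\<lambda>y. vec_index y i"] that v(1) A(1)
    by (simp add: scalar_prod_def lessThan_atLeast0)
  \<comment> \<open>\<open>s\<close> is the Hermitian form of the matrix at \<open>v\<close>, and
    \<open>N\<close> the squared norm of \<open>v\<close>. Symmetry gives \<open>cnj s = s\<close>,
    and with \<open>s = k * N\<close> this makes \<open>k\<close> real.\<close>
  define s where "s = (\<Sum>i<n. \<Sum>j<n. cnj (vec_index v i) * of_real (A $$ (i, j)) * vec_index v j)"
  define N where "N = (\<Sum>i<n. (cmod (vec_index v i))\<^sup>2)"
  have "s = (\<Sum>i<n. cnj (vec_index v i) * (\<Sum>j<n. of_real (A $$ (i, j)) * vec_index v j))"
    by (simp add: s_def sum_distrib_left mult.assoc)
  also have "\<dots> = (\<Sum>i<n. k * of_real ((cmod (vec_index v i))\<^sup>2))"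
  proof (intro sum.cong refl)
    fix i assume "i \<in> {..<n}"
    then show "cnj (vec_index v i) * (\<Sum>j<n. of_real (A $$ (i, j)) * vec_index v j) =
        k * of_real ((cmod (vec_index v i))\<^sup>2)"
      unfolding complex_norm_square by (simp add: row)
  qed
  finally have s: "s = k * of_real N"
    by (simp add: N_def sum_distrib_left)
  have "cnj s = (\<Sum>i<n. \<Sum>j<n. cnj (vec_index v j) * of_real (A $$ (j, i)) * vec_index v i)"
    unfolding s_def cnj_sum using sym
    by (intro sum.cong refl) (simp add: mult_ac)
  also have "\<dots> = s"
    unfolding s_def by (rule sum.swap)
  finally have "cnj k * of_real N = k * of_real N"
    by (simp add: s)
  moreover have "N \<noteq> 0"
  proof
    assume "N = 0"
    then have "\<forall>i<n. vec_index v i = 0"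
      by (simp add: N_def sum_nonneg_eq_0_iff)
    then show False using v(1,2) by (auto simp: vec_eq_iff)
  qed
  ultimately have "k \<in> \<real>"
    by (simp add: complex_is_Real_iff complex_eq_iff)
  then obtain r where r: "k = of_real r" by (auto elim: Reals_cases)
  have "char_poly ?B = map_poly of_real (char_poly A)"
    by (rule of_real_hom.char_poly_hom[OF A(1)])
  then have "poly (map_poly of_real (char_poly A)) (complex_of_real r) = 0"
    using k by (simp add: spectrum_root_char_poly[OF B] r)
  then have "poly (char_poly A) r = 0"
    by simp
  then show ?thesis
    using spectrum_root_char_poly[OF A(1)] by blast
qed

subsection \<open>Stars\<close>

text \<open>The ray from a point \<open>z\<close> of the complement, pointing away from 0, avoids
  \<open>D\<close>: scaling one of its points by \<open>1 / s\<close> would put \<open>z\<close>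
  into \<open>D\<close>. So the component of \<open>z\<close> is unbounded.\<close>

lemma outside_star_shaped:
  fixes D :: "complex set"
  assumes "0 \<in> D" and star: "\<And>z t. z \<in> D \<Longrightarrow> 0 \<le> t \<Longrightarrow> t \<le> 1 \<Longrightarrow> t *\<^sub>R z \<in> D"
  shows "outside D = - D"
proof -
  have "\<not> bounded (connected_component_set (- D) z)" if z: "z \<notin> D" for z
  proof
    assume "bounded (connected_component_set (- D) z)"
    moreover have "(\<lambda>s. s *\<^sub>R z) ` {1..} \<subseteq> connected_component_set (- D) z"
    proof (rule connected_component_maximal)
      show "z \<in> (\<lambda>s. s *\<^sub>R z) ` {1..}"
        by (rule image_eqI[of _ _ 1]) auto
      show "topological_space_class.connected ((\<lambda>s. s *\<^sub>R z) ` {1..})"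
        by (intro connected_continuous_image continuous_intros convex_connected) auto
      show "(\<lambda>s. s *\<^sub>R z) ` {1..} \<subseteq> - D"
      proof clarify
        fix s :: real assume "1 \<le> s" "s *\<^sub>R z \<in> D"
        then show False
          using star[of "s *\<^sub>R z" "1 / s"] z by simp
      qed
    qed
    ultimately have "bounded ((\<lambda>s. s *\<^sub>R z) ` {1..})"
      by (rule bounded_subset)
    then obtain B where B: "\<And>s. 1 \<le> s \<Longrightarrow> norm (s *\<^sub>R z) \<le> B"
      unfolding bounded_iff by auto
    have "z \<noteq> 0" using z assms(1) by auto
    have "norm z \<le> B" using B[of 1] by simp
    then have "0 \<le> B" using norm_ge_zero[of z] by linarith
    then have "norm (((B + 1) / norm z + 1) *\<^sub>R z) = B + 1 + norm z"
      using \<open>z \<noteq> 0\<close> by (simp add: field_simps)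
    moreover have "1 \<le> (B + 1) / norm z + 1"
      using \<open>0 \<le> B\<close> by simp
    ultimately show False
      using B[of "(B + 1) / norm z + 1"] norm_ge_zero[of z] by simp
  qed
  then show ?thesis by (auto simp: outside_def)
qed

locale star_graph =
  fixes S :: "'a pair_pre_digraph" and c :: 'a and W :: "'a set"
  assumes verts: "pverts S = insert c W" and arcs: "parcs S = {c} \<times> W \<union> W \<times> {c}"
    and centre: "c \<notin> W" and finite_leaves: "finite W"
begin

lemma bipartite: "bipartite S"
  unfolding Defs.bipartite_def using verts arcs centre
  by (intro exI[of _ "{c}"] exI[of _ W]) auto

text \<open>The centre is drawn at 0 and the leaves at distinct integer heights on the line of real
  part 1, joined by straight segments. This drawing is star-shaped about 0, so its whole complement
  is outside.\<close>

lemma outerplanar: "outerplanar S"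
proof -
  obtain f :: "'a \<Rightarrow> nat" where f: "inj_on f W"
    using finite_imp_inj_to_nat_seg[OF finite_leaves] by blast
  define pos where "pos v = (if v = c then 0 else Complex 1 (f v))" for v
  define crv where "crv e = linepath (pos (fst e)) (pos (snd e))" for e
  define seg where "seg w = closed_segment 0 (pos w)" for w
  have pos_leaf: "pos w = Complex 1 (f w)" if "w \<in> W" for w
    using that centre by (auto simp: pos_def)
  have leaf_ne: "w \<noteq> c" if "w \<in> W" for w using that centre by auto
  \<comment> \<open>\<open>seg w\<close> lies on the line through 0 of slope \<open>f w\<close>, so
    distinct segments meet only in 0. The bounds on \<open>Re z\<close> serve to leave the drawing
    sideways near each vertex.\<close>
  have seg: "Im z = f w * Re z \<and> 0 \<le> Re z \<and> Re z \<le> 1" if "z \<in> seg w" "w \<in> W" for z w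
    using that(1) pos_leaf[OF that(2)] by (auto simp: seg_def in_segment)
  have pos_zero: "pos c = 0" by (simp add: pos_def)
  have inj: "inj_on pos (pverts S)"
    using f centre by (auto simp: verts inj_on_def pos_def complex_eq_iff)
  have image: "path_image (crv (c, w)) = seg w" "path_image (crv (w, c)) = seg w" for w
    by (auto simp: crv_def seg_def pos_zero closed_segment_commute)
  have seg_verts: "seg w \<inter> pos ` pverts S = {0, pos w}" if w: "w \<in> W" for w
  proof
    show "{0, pos w} \<subseteq> seg w \<inter> pos ` pverts S"
      using w by (auto simp: seg_def verts pos_zero)
    show "seg w \<inter> pos ` pverts S \<subseteq> {0, pos w}"
    proof
      fix z assume "z \<in> seg w \<inter> pos ` pverts S"
      then obtain v where v: "v \<in> pverts S" "z = pos v" "pos v \<in> seg w" by blast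
      show "z \<in> {0, pos w}"
      proof (cases "v = c")
        case False
        then have "v \<in> W" using v(1) by (simp add: verts)
        then show ?thesis
          using seg[OF v(3) w] v(2) pos_leaf[of v] pos_leaf[OF w] by simp
      qed (simp add: v(2) pos_zero)
    qed
  qed
  have seg_meet: "seg v \<inter> seg w \<subseteq> {0}" if vw: "v \<in> W" "w \<in> W" "v \<noteq> w" for v w
  proof
    fix z assume "z \<in> seg v \<inter> seg w"
    then have z: "Im z = f v * Re z" "Im z = f w * Re z"
      using seg[of z v] seg[of z w] vw by blast+
    moreover have "real (f v) \<noteq> real (f w)"
      using inj_onD[OF f] vw by auto
    ultimately have "Re z = 0" by (metis mult_right_cancel)
    with z(1) show "z \<in> {0}" by (simp add: complex_eq_iff)
  qed
  have edge: "arc (crv (u, v)) \<and> pathstart (crv (u, v)) = pos u \<and>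
      pathfinish (crv (u, v)) = pos v \<and> crv (v, u) = reversepath (crv (u, v)) \<and>
      path_image (crv (u, v)) \<inter> pos ` pverts S = {pos u, pos v}"
    if uv: "(u, v) \<in> parcs S" for u v
  proof -
    have "u \<noteq> v" "u \<in> pverts S" "v \<in> pverts S"
      using uv leaf_ne by (auto simp: arcs verts)
    then have "pos u \<noteq> pos v" using inj by (auto dest: inj_onD)
    moreover have "path_image (crv (u, v)) \<inter> pos ` pverts S = {pos u, pos v}"
    proof (cases "u = c")
      case True
      then have "v \<in> W" using uv centre by (auto simp: arcs)
      then show ?thesis by (simp only: True image seg_verts pos_zero)
    next
      case False
      then have "u \<in> W" "v = c" using uv by (auto simp: arcs)
      then show ?thesis by (simp only: image seg_verts pos_zero insert_commute)
    qed
    ultimately show ?thesis by (simp add: crv_def)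
  qed
  have star_edge: "\<exists>a\<in>W. {u, v} = {c, a} \<and> path_image (crv (u, v)) = seg a"
    if "(u, v) \<in> parcs S" for u v
    using that image by (auto simp: arcs)
  have meet: "path_image (crv (u, v)) \<inter> path_image (crv (x, y)) \<subseteq> pos ` ({u, v} \<inter> {x, y})"
    if e: "(u, v) \<in> parcs S" "(x, y) \<in> parcs S" "{u, v} \<noteq> {x, y}" for u v x y
  proof -
    obtain a where a: "a \<in> W" "{u, v} = {c, a}" "path_image (crv (u, v)) = seg a"
      using star_edge[OF e(1)] by blast
    obtain b where b: "b \<in> W" "{x, y} = {c, b}" "path_image (crv (x, y)) = seg b"
      using star_edge[OF e(2)] by blast
    have "a \<noteq> b" using a(2) b(2) e(3) by metis
    then show ?thesis
      using seg_meet[OF a(1) b(1)] pos_zero unfolding a(2,3) b(2,3) by fastforce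
  qed
  have "planar_embedding S pos crv"
    unfolding planar_embedding_def using inj edge meet by blast
  moreover have "pos v \<in> frontier (outside (drawing S pos crv))" if v: "v \<in> pverts S" for v
  proof -
    let ?D = "drawing S pos crv"
    have D: "?D = insert 0 (\<Union>w\<in>W. seg w)"
      using image pos_zero by (auto simp: drawing_def verts arcs seg_def)
    have "outside ?D = - ?D"
    proof (rule outside_star_shaped)
      fix z and t :: real assume z: "z \<in> ?D" and t: "0 \<le> t" "t \<le> 1"
      have "t *\<^sub>R z \<in> seg w" if zw: "z \<in> seg w" for w
      proof -
        obtain r where r: "0 \<le> r" "r \<le> 1" "z = r *\<^sub>R pos w"
          using zw by (auto simp: seg_def in_segment)
        then show ?thesis
          using t unfolding seg_def in_segment
          by (intro exI[of _ "t * r"]) (simp add: mult_le_one)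
      qed
      with z show "t *\<^sub>R z \<in> ?D" unfolding D by auto
    qed (simp add: D)
    moreover have "pos v \<in> ?D" using v by (auto simp: drawing_def)
    moreover have "\<exists>y\<in>- ?D. dist y (pos v) < e" if e: "0 < e" for e
    proof -
      \<comment> \<open>A small horizontal shift out of the strip containing the drawing: leftwards
        from the centre, rightwards from a leaf.\<close>
      define y where "y = pos v + (if v = c then - complex_of_real (e / 2) else complex_of_real (e / 2))"
      have "Re y < 0 \<or> 1 < Re y"
        using e v by (auto simp: y_def verts pos_def)
      moreover have "0 \<le> Re z \<and> Re z \<le> 1" if "z \<in> ?D" for z
        using that seg by (auto simp: D)
      ultimately have "y \<in> - ?D" by fastforce
      moreover have "dist y (pos v) < e"
        using e by (simp add: y_def dist_norm norm_divide)
      ultimately show ?thesis by blast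
    qed
    ultimately show ?thesis
      using interior_subset[of "- ?D"] by (auto simp: frontier_def closure_approachable)
  qed
  ultimately show ?thesis
    unfolding outerplanar_def by blast
qed

text \<open>The weight \<open>sqrt (card W)\<close> on the centre and 1 on every leaf is an
  eigenvector, and \<open>\<rho>\<close> is the maximum of a finite spectrum.\<close>

lemma sqrt_le_spectral_radius:
  assumes "W \<noteq> {}"
  shows "sqrt (card W) \<le> \<rho> S"
proof -
  obtain vs where vs: "distinct vs" "set vs = pverts S"
    using finite_distinct_list[of "pverts S"] finite_leaves by (auto simp: verts)
  have leaf: "parcs S `` {w} = {c}" if "w \<in> W" for w
    using that centre by (auto simp: arcs)
  have centre_nbrs: "parcs S `` {c} = W"
    using centre by (auto simp: arcs)
  have "sqrt (card W) \<in> spectrum (adjacency_matrix S vs)"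
  proof (subst spectrum_adjacency_matrix_iff[OF vs])
    let ?x = "\<lambda>v. if v = c then sqrt (card W) else 1"
    have eigen: "sqrt (card W) * ?x v = (\<Sum>w \<in> parcs S `` {v}. ?x w)" if "v \<in> pverts S" for v
    proof (cases "v = c")
      case True
      have "(\<Sum>w\<in>W. ?x w) = (\<Sum>w\<in>W. 1)"
        using centre by (intro sum.cong) auto
      then show ?thesis using True centre_nbrs by simp
    next
      case False
      then show ?thesis using that leaf[of v] by (simp add: verts)
    qed
    have nonzero: "\<exists>v\<in>pverts S. ?x v \<noteq> 0"
      using assms centre by (auto simp: verts)
    show "\<exists>x. (\<exists>v\<in>pverts S. x v \<noteq> 0) \<and>
        (\<forall>v\<in>pverts S. sqrt (card W) * x v = (\<Sum>w \<in> parcs S `` {v}. x w))"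
      by (intro exI[of _ ?x] conjI ballI nonzero eigen)
  qed (auto simp: verts arcs)
  then show ?thesis
    unfolding graph_spectral_radius_eq[OF vs]
    using card_finite_spectrum(1)[of "adjacency_matrix S vs" "length vs"]
    by (intro Max_ge) (auto simp: adjacency_matrix_def)
qed

end

subsection \<open>The extremal bound\<close>

text \<open>The spectrum is finite and nonempty, so \<open>\<rho> G\<close> is itself an eigenvalue
  and \<open>spectral_bound\<close> applies to it; triangles are excluded by the two sides.\<close>

lemma spectral_radius_le:
  assumes G: "pair_graph G" "outerplanar G" "bipartite G" and n: "card (pverts G) > 344569"
  shows "\<rho> G \<le> sqrt (card (pverts G) - 1)"
proof -
  obtain pos crv where "planar_embedding G pos crv"
    "\<forall>v \<in> pverts G. pos v \<in> frontier (outside (drawing G pos crv))"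
    using G(2) unfolding outerplanar_def by blast
  then interpret bipartite_outer_drawing G pos crv
    using G by (intro bipartite_outer_drawing.intro) blast+
  obtain vs where vs: "distinct vs" "set vs = V"
    using finite_distinct_list[OF finite_V] by blast
  let ?A = "adjacency_matrix G vs"
  have A: "?A \<in> carrier_mat (length vs) (length vs)"
    by (simp add: adjacency_matrix_def)
  have "0 < length vs"
    using n vs by (metis card.empty length_0_conv list.set(1) not_less0 neq0_conv)
  then have "spectrum ?A \<noteq> {}"
    by (rule symmetric_spectrum_nonempty[OF A]) (auto simp: adjacency_matrix_def dest: edge_sym)
  then have "\<rho> G \<in> spectrum ?A"
    unfolding graph_spectral_radius_eq[OF vs] using card_finite_spectrum(1)[OF A]
    by (intro Max_in)
  moreover have E_V: "E \<subseteq> V \<times> V" using edge_in_V by auto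
  ultimately obtain x where x: "\<exists>v\<in>V. x v \<noteq> 0" "\<forall>v\<in>V. \<rho> G * x v = (\<Sum>w \<in> E `` {v}. x w)"
    unfolding spectrum_adjacency_matrix_iff[OF vs E_V] by blast
  have "(\<rho> G)\<^sup>2 \<le> card V - 1"
  proof (rule spectral_bound[OF finite_V E_V n edge_sym _ card_common_neighbours card_edges x(1)])
    show "(a, b) \<notin> E" if "(a, v) \<in> E" "(b, v) \<in> E" for a b v
      using that edge_side by blast
  qed (use x(2) in auto)
  then show ?thesis by (rule real_le_rsqrt)
qed

text \<open>\<open>S\<close> is any copy of the star, on a vertex type of its own. The first
  conjuncts give it all properties required of \<open>G\<close>, so it is an extremal graph and not
  merely the source of an upper bound.\<close>

theorem theorem1p3:
  fixes n :: nat and S :: "'b pair_pre_digraph"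
  assumes "n > 344569"
    and "K\<^bsub>1,n - 1\<^esub> (with_proj S)"
  shows "pair_graph S \<and> card (pverts S) = n \<and> outerplanar S \<and> bipartite S \<and>
    (\<forall>G :: 'a pair_pre_digraph.
       pair_graph G \<and> card (pverts G) = n \<and> outerplanar G \<and> bipartite G \<longrightarrow> \<rho> G \<le> \<rho> S)"
proof -
  obtain U W where UW: "pverts S = U \<union> W" "U \<inter> W = {}" "card U = 1" "card W = n - 1"
    "parcs S = U \<times> W \<union> W \<times> U" and fin: "finite (pverts S)"
    using assms(2) unfolding complete_bipartite_digraph_pair_def by blast
  obtain c where U: "U = {c}"
    using UW(3) by (auto simp: card_1_singleton_iff)
  interpret star_graph S c W
    by unfold_locales (use UW U fin in auto)
  have "card (pverts S) = n"
    using assms(1) finite_leaves centre UW(4) by (simp add: verts)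
  moreover have "W \<noteq> {}"
    using assms(1) UW(4) by auto
  then have "sqrt (n - 1) \<le> \<rho> S"
    using sqrt_le_spectral_radius UW(4) by simp
  then have "\<rho> G \<le> \<rho> S"
    if "pair_graph G" "card (pverts G) = n" "outerplanar G" "Defs.bipartite G"
    for G :: "'a pair_pre_digraph"
    using spectral_radius_le[OF that(1,3,4)] that(2) assms(1) by simp
  ultimately show ?thesis
    using pair_graphI_complete_bipartite[OF assms(2)] outerplanar bipartite by blast
qed

end
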